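(* For every $q \in \mathbb{Q} \cap (0,1)$ such that $\mathsf{n}(q) > 1$ and $\mathsf{d}(q)$ is a prime number, the positive semiring $\mathbb{N}_0[q] = \{f(q) \mid f \in \mathbb{N}_0[x]\}$ is bi-atomic but does not satisfy the bi-ACCP.
   Context: $\mathbb{N}_0$ denotes the set of nonnegative integers. For a positive rational $q$, $\mathsf{n}(q)$ and $\mathsf{d}(q)$ denote the unique positive integers $n$ and $d$ with $q = n/d$ and $\gcd(n,d) = 1$. A positive semiring is a subset $S \subseteq \mathbb{R}_{\ge 0}$ containing $0$ and $1$ and closed under the usual addition and multiplication; its additive monoid is $(S,+)$ and its multiplicative monoid is $(S \setminus \{0\},\cdot)$. A monoid is a cancellative commutative semigroup with identity. An atom of a monoid is a non-invertible element that is not a product (sum, in additive notation) of two non-invertible elements; a monoid is atomic if every non-invertible element is a finite product (sum) of atoms. A monoid $(M,* )$ satisfies the ACCP if every ascending chain of principal ideals $x * M = \{x*y \mid y \in M\}$ stabilizes. A positive semiring $S$ is bi-atomic (resp. satisfies the bi-ACCP) if both $(S,+)$ and $(S \setminus \{0\},\cdot)$ are atomic (resp. satisfy the ACCP). *)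

theory Defs
  imports
    Complex_Main
    "HOL-Algebra.Group"
    "HOL-Computational_Algebra.Polynomial"
    "HOL-Computational_Algebra.Primes"
begin

definition atom :: "('a, 'b) monoid_scheme \<Rightarrow> 'a \<Rightarrow> bool" where
  "atom M a \<longleftrightarrow> a \<in> carrier M - Units M \<and>
     \<not> (\<exists>b \<in> carrier M - Units M. \<exists>c \<in> carrier M - Units M. a = b \<otimes>\<^bsub>M\<^esub> c)"

definition atomic_monoid :: "('a, 'b) monoid_scheme \<Rightarrow> bool" where
  "atomic_monoid M \<longleftrightarrow>
     (\<forall>x \<in> carrier M - Units M. \<exists>as. (\<forall>a \<in> set as. atom M a) \<and> x = foldr (\<otimes>\<^bsub>M\<^esub>) as \<one>\<^bsub>M\<^esub>)"

definition principal_ideal :: "('a, 'b) monoid_scheme \<Rightarrow> 'a \<Rightarrow> 'a set" where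
  "principal_ideal M x = {x \<otimes>\<^bsub>M\<^esub> y | y. y \<in> carrier M}"

definition ACCP :: "('a, 'b) monoid_scheme \<Rightarrow> bool" where
  "ACCP M \<longleftrightarrow>
     (\<forall>x :: nat \<Rightarrow> 'a.
        (\<forall>n. x n \<in> carrier M) \<and> (\<forall>n. principal_ideal M (x n) \<subseteq> principal_ideal M (x (Suc n))) \<longrightarrow>
        (\<exists>N. \<forall>n \<ge> N. principal_ideal M (x n) = principal_ideal M (x N)))"

definition positive_semiring :: "real set \<Rightarrow> bool" where
  "positive_semiring S \<longleftrightarrow> S \<subseteq> {0..} \<and> 0 \<in> S \<and> 1 \<in> S \<and>
     (\<forall>x \<in> S. \<forall>y \<in> S. x + y \<in> S \<and> x * y \<in> S)"

definition additive_monoid :: "real set \<Rightarrow> real monoid" where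
  "additive_monoid S = \<lparr>carrier = S, monoid.mult = (+), monoid.one = 0\<rparr>"

definition multiplicative_monoid :: "real set \<Rightarrow> real monoid" where
  "multiplicative_monoid S = \<lparr>carrier = S - {0}, monoid.mult = (*), monoid.one = 1\<rparr>"

definition bi_atomic :: "real set \<Rightarrow> bool" where
  "bi_atomic S \<longleftrightarrow> atomic_monoid (additive_monoid S) \<and> atomic_monoid (multiplicative_monoid S)"

definition bi_ACCP :: "real set \<Rightarrow> bool" where
  "bi_ACCP S \<longleftrightarrow> ACCP (additive_monoid S) \<and> ACCP (multiplicative_monoid S)"

definition nat_poly_semiring :: "real \<Rightarrow> real set" where
  "nat_poly_semiring r = {poly (map_poly of_nat f) r | f :: nat poly. True}"

lemma comm_monoid_additive_monoid:
  assumes "positive_semiring S"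
  shows "comm_monoid (additive_monoid S)"
  using assms unfolding positive_semiring_def additive_monoid_def
  by (intro comm_monoidI) auto

lemma comm_monoid_multiplicative_monoid:
  assumes "positive_semiring S"
  shows "comm_monoid (multiplicative_monoid S)"
  using assms unfolding positive_semiring_def multiplicative_monoid_def
  by (intro comm_monoidI) auto

lemma positive_semiring_nat_poly_semiring:
  assumes "0 \<le> r"
  shows "positive_semiring (nat_poly_semiring r)"
proof -
  let ?e = "\<lambda>f :: nat poly. poly (map_poly of_nat f) r"
  have add: "?e f + ?e g = ?e (f + g)" for f g
  proof -
    have "map_poly real (f + g) = map_poly real f + map_poly real g"
      by (rule poly_eqI) (simp add: coeff_map_poly)
    then show ?thesis by simp
  qed
  have mult: "?e f * ?e g = ?e (f * g)" for f g
  proof -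
    have "map_poly real (f * g) = map_poly real f * map_poly real g"
      by (rule poly_eqI) (simp add: coeff_map_poly coeff_mult)
    then show ?thesis by simp
  qed
  have "0 \<le> ?e f" for f
    using assms by (auto simp: poly_altdef coeff_map_poly intro!: sum_nonneg)
  moreover have "\<exists>f. ?e f = 0" by (rule exI[of _ 0]) simp
  moreover have "\<exists>f. ?e f = 1" by (rule exI[of _ 1]) (simp add: map_poly_1)
  ultimately show ?thesis
    unfolding positive_semiring_def nat_poly_semiring_def
    by (auto simp: add mult eq_commute[of 0] eq_commute[of 1])
qed

end

theory Submission
  imports Defs
begin

text \<open>
  Write \<open>q = a / p\<close> with \<open>p\<close> prime. An element of \<open>\<nat>\<^sub>0[q]\<close> is
  \<open>c + q y\<close> with \<open>c\<close> a natural number and \<open>y\<close> again in \<open>\<nat>\<^sub>0[q]\<close>, so one that is smaller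
  than \<open>1\<close> is a multiple of \<open>q\<close>. Since \<open>q\<close> has no inverse, this makes all powers of \<open>q\<close>
  additive atoms. The elements \<open>a q\<^sup>n = a q\<^sup>n\<^sup>+\<^sup>1 + (p - a) q\<^sup>n\<^sup>+\<^sup>1\<close> violate the
  additive ACCP.

  For multiplicative atomicity, every nonzero element \<open>x\<close> is \<open>N\<close> times a power of \<open>p\<close> for a
  unique \<open>N\<close> coprime to \<open>p\<close>, and \<open>\<mu> x = N\<^sup>p x\<close> is multiplicative with \<open>\<mu> x \<ge> 2\<close> unless
  \<open>x = 1\<close>: if \<open>x > 1\<close>, then \<open>N \<ge> 2\<close> or \<open>x\<close> is a proper power of \<open>p\<close>; if \<open>x < 1\<close>, divide by
  \<open>q\<close> and use \<open>\<mu> q = a\<^sup>p\<^sup>+\<^sup>1 / p \<ge> 2\<close>. Hence factorization lengths are bounded by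
  \<open>log\<^sub>2 (\<mu> x)\<close>.
\<close>

text \<open>A proper splitting leaves each factor with at most half the size, because the other
  factor has size at least \<open>2\<close>. So splitting terminates, and induction on a bound
  \<open>2 ^ n\<close> for the size yields a factorization.\<close>

lemma atomic_monoid_if_multiplicative_size:
  fixes M (structure) and \<mu> :: "'a \<Rightarrow> real"
  assumes "monoid M"
    and mult: "\<And>x y. x \<in> carrier M \<Longrightarrow> y \<in> carrier M \<Longrightarrow> \<mu> (x \<otimes> y) = \<mu> x * \<mu> y"
    and ge_2: "\<And>x. x \<in> carrier M - Units M \<Longrightarrow> 2 \<le> \<mu> x"
  shows "atomic_monoid M"
proof -
  interpret monoid M by fact
  have foldr_closed: "set as \<subseteq> carrier M \<Longrightarrow> foldr (\<otimes>) as \<one> \<in> carrier M" for as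
    by (induction as) auto
  have foldr_append: "set as \<subseteq> carrier M \<Longrightarrow> set bs \<subseteq> carrier M \<Longrightarrow>
      foldr (\<otimes>) (as @ bs) \<one> = foldr (\<otimes>) as \<one> \<otimes> foldr (\<otimes>) bs \<one>" for as bs
    by (induction as) (auto simp: foldr_closed m_assoc simp del: foldr_append)
  have "\<exists>as. (\<forall>a \<in> set as. atom M a) \<and> x = foldr (\<otimes>) as \<one>"
    if "x \<in> carrier M - Units M" "\<mu> x < 2 ^ n" for x n
    using that
  proof (induction n arbitrary: x)
    case 0
    \<comment> \<open>Vacuous: no non-unit has size below \<open>2 ^ 0 = 1\<close>.\<close>
    then show ?case using ge_2[of x] by auto
  next
    case (Suc n)
    show ?case
    proof (cases "atom M x")
      case True
      then show ?thesis using Suc.prems by (intro exI[of _ "[x]"]) auto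
    next
      case False
      then obtain b c where bc: "b \<in> carrier M - Units M" "c \<in> carrier M - Units M" "x = b \<otimes> c"
        using Suc.prems by (auto simp: atom_def)
      then have "\<mu> x = \<mu> b * \<mu> c" "2 \<le> \<mu> b" "2 \<le> \<mu> c"
        using mult ge_2 by auto
      moreover from this have "\<mu> b * 2 \<le> \<mu> x" "2 * \<mu> c \<le> \<mu> x"
        by (auto intro!: mult_left_mono mult_right_mono)
      ultimately have "\<mu> b < 2 ^ n" "\<mu> c < 2 ^ n"
        using Suc.prems(2) unfolding power_Suc by linarith+
      then obtain as bs where
        "\<forall>a \<in> set as. atom M a" "b = foldr (\<otimes>) as \<one>"
        "\<forall>a \<in> set bs. atom M a" "c = foldr (\<otimes>) bs \<one>"
        using Suc.IH bc by meson
      moreover from this have "set as \<subseteq> carrier M" "set bs \<subseteq> carrier M"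
        by (auto simp: atom_def)
      ultimately show ?thesis
        using bc foldr_append by (intro exI[of _ "as @ bs"]) auto
    qed
  qed
  moreover have "\<exists>n. \<mu> x < 2 ^ n" for x
    by (simp add: real_arch_pow)
  ultimately show ?thesis
    unfolding atomic_monoid_def by blast
qed

section \<open>Horner form of the elements of \<open>nat_poly_semiring r\<close>\<close>

lemma eval_nat_poly_pCons:
  "poly (map_poly real (pCons c f)) r = real c + r * poly (map_poly real f) r"
  by (simp add: map_poly_pCons)

lemma nat_poly_semiring_step:
  assumes "y \<in> nat_poly_semiring r"
  shows "real c + r * y \<in> nat_poly_semiring r"
  using assms unfolding nat_poly_semiring_def
  by (auto simp: eval_nat_poly_pCons[symmetric])

text \<open>Horner's scheme builds every value from \<open>0\<close> by
  \<open>y \<mapsto> c + r * y\<close>. Later inductions thus run over elements of the semiring and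
  never mention polynomials.\<close>

lemma nat_poly_semiring_induct [consumes 1, case_names zero step]:
  assumes "x \<in> nat_poly_semiring r"
    and "P 0"
    and step: "\<And>c y. y \<in> nat_poly_semiring r \<Longrightarrow> P y \<Longrightarrow> P (real c + r * y)"
  shows "P x"
proof -
  obtain f :: "nat poly" where x: "x = poly (map_poly real f) r"
    using assms(1) unfolding nat_poly_semiring_def by auto
  have "P (poly (map_poly real f) r)" for f
  proof (induction f)
    case 0
    then show ?case using \<open>P 0\<close> by simp
  next
    case (pCons c f)
    have "poly (map_poly real f) r \<in> nat_poly_semiring r"
      unfolding nat_poly_semiring_def by blast
    from step[OF this pCons.IH] show ?case
      by (simp only: eval_nat_poly_pCons)
  qed
  then show ?thesis using x by simp
qed

section \<open>The semiring generated by a fraction \<open>a / p\<close> in lowest terms\<close>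

locale proper_fraction =
  fixes a p :: nat and r :: real and S :: "real set"
  defines "r \<equiv> real a / real p" and "S \<equiv> nat_poly_semiring r"
  assumes a_gt_1: "1 < a" and a_less_p: "a < p" and coprime: "coprime a p" and prime: "prime p"
begin

lemma r_pos: "0 < r" and r_less_1: "r < 1"
  using a_gt_1 a_less_p by (auto simp: r_def)

lemma p_r: "real p * r = real a"
  using a_less_p by (simp add: r_def)

lemma positive_semiring_S: "positive_semiring S"
  unfolding S_def using r_pos by (intro positive_semiring_nat_poly_semiring) simp

lemma S_nonneg: "x \<in> S \<Longrightarrow> 0 \<le> x"
  and S_zero: "0 \<in> S"
  and S_one: "1 \<in> S"
  and S_add: "x \<in> S \<Longrightarrow> y \<in> S \<Longrightarrow> x + y \<in> S"
  and S_mult: "x \<in> S \<Longrightarrow> y \<in> S \<Longrightarrow> x * y \<in> S"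
  using positive_semiring_S unfolding positive_semiring_def by auto

lemma S_of_nat: "real c \<in> S"
  using nat_poly_semiring_step[of 0 r c] S_zero by (simp add: S_def)

lemma S_r: "r \<in> S"
  using nat_poly_semiring_step[of 1 r 0] S_one by (simp add: S_def)

lemma S_r_power: "r ^ k \<in> S"
  by (induction k) (auto intro: S_one S_mult S_r)

lemma S_induct [consumes 1, case_names zero step]:
  assumes "x \<in> S" and "P 0" and "\<And>c y. y \<in> S \<Longrightarrow> P y \<Longrightarrow> P (real c + r * y)"
  shows "P x"
  using assms unfolding S_def by (rule nat_poly_semiring_induct)

lemma S_cases:
  assumes "x \<in> S"
  obtains c y where "y \<in> S" "x = real c + r * y"
proof -
  have "\<exists>c y. y \<in> S \<and> x = real c + r * y"
    using assms
  proof (induction rule: S_induct)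
    case zero
    show ?case using S_zero by (intro exI[of _ 0]) auto
  qed auto
  then show thesis using that by auto
qed

text \<open>A nonzero constant term makes an element at least \<open>1\<close>, so below
  \<open>r ^ k \<le> 1\<close> it must vanish and \<open>r\<close> can be divided out. The
  successive bounds \<open>r ^ k\<close>, ..., \<open>r ^ 0\<close> permit \<open>k + 1\<close>
  divisions, hence the exponent \<open>Suc k\<close>.\<close>

lemma S_less_r_power:
  assumes "x \<in> S" "x < r ^ k"
  shows "\<exists>y\<in>S. x = r ^ Suc k * y"
  using assms
proof (induction k arbitrary: x)
  case 0
  obtain c y where y: "y \<in> S" "x = real c + r * y"
    using \<open>x \<in> S\<close> by (rule S_cases)
  moreover have "0 \<le> r * y"
    using y S_nonneg r_pos by auto
  ultimately have "c = 0"
    using 0 by auto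
  then show ?case using y by auto
next
  case (Suc k)
  obtain c y where y: "y \<in> S" "x = real c + r * y"
    using \<open>x \<in> S\<close> by (rule S_cases)
  have "r ^ Suc k < 1"
    using r_pos r_less_1 by (intro power_Suc_less_one) auto
  moreover have "0 \<le> r * y"
    using y S_nonneg r_pos by auto
  ultimately have "c = 0"
    using Suc.prems y by auto
  then have "x = r * y" using y by simp
  then have "y < r ^ k"
    using Suc.prems r_pos by simp
  then obtain z where "z \<in> S" "y = r ^ Suc k * z"
    using Suc.IH y by blast
  then show ?case
    using \<open>x = r * y\<close> by (intro bexI[of _ z]) auto
qed

lemma S_denominator:
  assumes "x \<in> S"
  shows "\<exists>i m. x * real p ^ i = real m"
  using assms
proof (induction rule: S_induct)
  case zero
  show ?case by (intro exI[of _ 0]) auto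
next
  case (step c y)
  then obtain i m where im: "y * real p ^ i = real m" by auto
  have "(real c + r * y) * real p ^ Suc i
      = real c * real p ^ Suc i + (real p * r) * (y * real p ^ i)"
    by (simp add: algebra_simps)
  also have "\<dots> = real (c * p ^ Suc i + a * m)"
    by (simp add: im p_r)
  finally show ?case by blast
qed

text \<open>Clearing the denominator of an inverse would give \<open>p ^ Suc i = a * m\<close>, so
  that \<open>a > 1\<close> divides a power of \<open>p\<close> although it is coprime to
  it.\<close>

lemma r_not_invertible:
  assumes "x \<in> S"
  shows "r * x \<noteq> 1"
proof
  assume "r * x = 1"
  obtain i m where im: "x * real p ^ i = real m"
    using S_denominator[OF assms] by auto
  have "real (p ^ Suc i) = (r * x) * real p ^ Suc i"
    using \<open>r * x = 1\<close> by simp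
  also have "\<dots> = (real p * r) * (x * real p ^ i)"
    by simp
  also have "\<dots> = real (a * m)"
    by (simp add: im p_r)
  finally have "p ^ Suc i = a * m"
    by (simp only: of_nat_eq_iff)
  then have "a dvd p ^ Suc i"
    by simp
  moreover have "coprime a (p ^ Suc i)"
    using coprime by (rule coprime_power_right_iff[THEN iffD2, OF disjI1])
  ultimately show False
    using a_gt_1 coprime_absorb_left[of a "p ^ Suc i"] by simp
qed

section \<open>Additive monoid: atoms, atomicity and failure of the ACCP\<close>

lemma Units_additive: "Units (additive_monoid S) = {0}"
proof (intro equalityI subsetI)
  fix x assume "x \<in> Units (additive_monoid S)"
  then obtain y where "x \<in> S" "y \<in> S" "x + y = 0"
    by (auto simp: Units_def additive_monoid_def)
  then show "x \<in> {0}"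
    using S_nonneg[of x] S_nonneg[of y] by simp
next
  fix x :: real assume "x \<in> {0}"
  then show "x \<in> Units (additive_monoid S)"
    using S_zero by (auto simp: Units_def additive_monoid_def)
qed

text \<open>Two nonzero summands of \<open>r ^ k\<close> are both smaller than it, hence both
  multiples of \<open>r ^ Suc k\<close>. Cancelling \<open>r ^ k\<close> would then exhibit an
  inverse of \<open>r\<close>.\<close>

lemma atom_r_power: "atom (additive_monoid S) (r ^ k)"
proof -
  have False if bc: "b \<in> S" "b \<noteq> 0" "c \<in> S" "c \<noteq> 0" "r ^ k = b + c" for b c
  proof -
    have "b < r ^ k" "c < r ^ k"
      using bc S_nonneg[of b] S_nonneg[of c] by auto
    then obtain y z where yz: "y \<in> S" "z \<in> S" "b = r ^ Suc k * y" "c = r ^ Suc k * z"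
      using S_less_r_power[OF bc(1)] S_less_r_power[OF bc(3)] by blast
    have "r ^ k * (r * (y + z)) = b + c"
      unfolding yz by (simp add: algebra_simps)
    then have "r * (y + z) = 1"
      using r_pos by (simp flip: bc(5))
    then show False
      using r_not_invertible S_add yz by blast
  qed
  moreover have "r ^ k \<noteq> 0"
    using r_pos by simp
  ultimately show ?thesis
    unfolding atom_def Units_additive using S_r_power
    by (auto simp: additive_monoid_def)
qed

lemma S_sum_of_powers:
  assumes "x \<in> S"
  shows "\<exists>ks. x = (\<Sum>k\<leftarrow>ks. r ^ k)"
  using assms
proof (induction rule: S_induct)
  case zero
  show ?case by (intro exI[of _ "[]"]) auto
next
  case (step c y)
  then obtain ks where "y = (\<Sum>k\<leftarrow>ks. r ^ k)" by auto
  \<comment> \<open>The constant \<open>c\<close> contributes \<open>c\<close> copies of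
    \<open>r ^ 0\<close>, and multiplication by \<open>r\<close> raises every exponent by
    one.\<close>
  then have "real c + r * y = (\<Sum>k\<leftarrow>replicate c 0 @ map Suc ks. r ^ k)"
    by (simp add: sum_list_replicate sum_list_const_mult o_def)
  then show ?case by blast
qed

lemma atomic_additive: "atomic_monoid (additive_monoid S)"
  unfolding atomic_monoid_def
proof
  fix x assume "x \<in> carrier (additive_monoid S) - Units (additive_monoid S)"
  then obtain ks where "x = (\<Sum>k\<leftarrow>ks. r ^ k)"
    using S_sum_of_powers by (auto simp: additive_monoid_def)
  then show "\<exists>as. (\<forall>a\<in>set as. atom (additive_monoid S) a) \<and>
      x = foldr (\<otimes>\<^bsub>additive_monoid S\<^esub>) as \<one>\<^bsub>additive_monoid S\<^esub>"
    using atom_r_power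
    by (intro exI[of _ "map (\<lambda>k. r ^ k) ks"])
      (auto simp: additive_monoid_def sum_list.eq_foldr)
qed

lemma not_ACCP_additive: "\<not> ACCP (additive_monoid S)"
proof
  assume accp: "ACCP (additive_monoid S)"
  define x where "x n = real a * r ^ n" for n
  have ideal: "principal_ideal (additive_monoid S) z = {z + y | y. y \<in> S}" for z
    by (simp add: principal_ideal_def additive_monoid_def)
  have x_in: "x n \<in> S" for n
    unfolding x_def by (intro S_mult S_of_nat S_r_power)
  have "x n = x (Suc n) + real (p - a) * r ^ Suc n" for n
  proof -
    \<comment> \<open>Replacing \<open>a\<close> by \<open>p * r\<close> gives \<open>p\<close>
      copies of \<open>r ^ Suc n\<close>, which split into \<open>a\<close> copies and
      \<open>p - a\<close> copies.\<close>
    have "x n = real p * r * r ^ n"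
      by (simp add: x_def p_r)
    then show ?thesis
      using a_less_p by (simp add: x_def of_nat_diff algebra_simps)
  qed
  moreover have "real (p - a) * r ^ Suc n \<in> S" for n
    by (intro S_mult S_of_nat S_r_power)
  ultimately have "\<exists>d\<in>S. x n = x (Suc n) + d" for n
    by blast
  then have "\<exists>y'\<in>S. x n + y = x (Suc n) + y'" if "y \<in> S" for n y
    using that S_add by (metis add.assoc)
  then have "principal_ideal (additive_monoid S) (x n)
      \<subseteq> principal_ideal (additive_monoid S) (x (Suc n))" for n
    unfolding ideal by blast
  moreover have "\<forall>n. x n \<in> carrier (additive_monoid S)"
    using x_in by (simp add: additive_monoid_def)
  ultimately obtain N where
    "\<forall>n\<ge>N. principal_ideal (additive_monoid S) (x n) = principal_ideal (additive_monoid S) (x N)"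
    using accp unfolding ACCP_def by blast
  from this[rule_format, of "Suc N"] have "{x (Suc N) + y | y. y \<in> S} = {x N + y | y. y \<in> S}"
    by (simp add: ideal)
  \<comment> \<open>Elements of the ideal of \<open>x N\<close> are at least \<open>x N\<close>, so
    equality of the two ideals contradicts the strict decrease of \<open>x\<close>.\<close>
  moreover have "x (Suc N) \<in> {x (Suc N) + y | y. y \<in> S}"
    using S_zero by force
  ultimately have "x N \<le> x (Suc N)"
    using S_nonneg by auto
  moreover have "x (Suc N) < x N"
    using a_gt_1 r_pos r_less_1 by (simp add: x_def)
  ultimately show False by simp
qed

section \<open>Multiplicative monoid: the part coprime to \<open>p\<close> and the size
  function\<close>

definition p_free_part :: "real \<Rightarrow> nat \<Rightarrow> bool" where
  "p_free_part x N \<longleftrightarrow> 0 < N \<and> coprime N p \<and> (\<exists>i j. x * real p ^ i = real N * real p ^ j)"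

text \<open>Cross-multiplying two representations equates \<open>N\<close> and \<open>N'\<close> up
  to powers of \<open>p\<close>. Coprimality to \<open>p\<close> then makes each divide the
  other.\<close>

lemma p_free_part_unique:
  assumes "p_free_part x N" "p_free_part x N'"
  shows "N = N'"
proof -
  have dvd: "M dvd M'" if "p_free_part x M" "p_free_part x M'" for M M'
  proof -
    obtain i j i' j' where
      eq: "x * real p ^ i = real M * real p ^ j" "x * real p ^ i' = real M' * real p ^ j'"
      and "coprime M p"
      using \<open>p_free_part x M\<close> \<open>p_free_part x M'\<close> unfolding p_free_part_def by auto
    have "real M * real p ^ j * real p ^ i' = real M' * real p ^ j' * real p ^ i"
      unfolding eq[symmetric] by simp
    then have "real (M * p ^ (j + i')) = real (M' * p ^ (j' + i))"
      by (simp add: power_add)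
    then have "M * p ^ (j + i') = M' * p ^ (j' + i)"
      by (simp only: of_nat_eq_iff)
    then have "M dvd M' * p ^ (j' + i)"
      by (metis dvd_triv_left)
    then show ?thesis
      using \<open>coprime M p\<close> by (simp add: coprime_dvd_mult_left_iff)
  qed
  show ?thesis
    using dvd assms by (intro dvd_antisym) auto
qed

lemma p_free_part_mult:
  assumes "p_free_part x N" "p_free_part y M"
  shows "p_free_part (x * y) (N * M)"
proof -
  obtain i j i' j' where
    "x * real p ^ i = real N * real p ^ j" "y * real p ^ i' = real M * real p ^ j'"
    using assms unfolding p_free_part_def by auto
  then have "(x * real p ^ i) * (y * real p ^ i') = (real N * real p ^ j) * (real M * real p ^ j')"
    by simp
  then have "x * y * real p ^ (i + i') = real (N * M) * real p ^ (j + j')"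
    by (simp add: power_add mult_ac)
  then show ?thesis
    using assms unfolding p_free_part_def by auto
qed

text \<open>Clear the denominator and strip all factors \<open>p\<close> from the resulting natural
  number. The power of \<open>p\<close> left over may be negative, which is why
  \<open>p_free_part\<close> has powers of \<open>p\<close> on both sides.\<close>

lemma p_free_part_exists:
  assumes "x \<in> S" "x \<noteq> 0"
  shows "\<exists>N. p_free_part x N"
proof -
  obtain i m where im: "x * real p ^ i = real m"
    using S_denominator[OF assms(1)] by auto
  moreover have "x * real p ^ i \<noteq> 0"
    using assms a_less_p by simp
  ultimately have "m \<noteq> 0"
    by simp
  then obtain N where N: "m = p ^ multiplicity p m * N" "\<not> p dvd N"
    using prime by (metis multiplicity_decompose' not_prime_unit)
  then have "coprime N p"
    using prime by (metis coprime_commute prime_imp_coprime)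
  moreover have "x * real p ^ i = real N * real p ^ multiplicity p m"
    unfolding im by (subst N(1)) simp
  ultimately show ?thesis
    using N \<open>m \<noteq> 0\<close> unfolding p_free_part_def by (metis gr0I mult_0_right)
qed

text \<open>This is \<open>\<mu>\<close>. By existence and uniqueness, the description is meaningful
  on every nonzero element of \<open>S\<close>.\<close>

definition size_fun :: "real \<Rightarrow> real" where
  "size_fun x = real (THE N. p_free_part x N) ^ p * x"

lemma size_fun_eq: "p_free_part x N \<Longrightarrow> size_fun x = real N ^ p * x"
  unfolding size_fun_def using p_free_part_unique by (metis the_equality)

lemma size_fun_mult:
  assumes "x \<in> S - {0}" "y \<in> S - {0}"
  shows "size_fun (x * y) = size_fun x * size_fun y"
proof -
  obtain N M where NM: "p_free_part x N" "p_free_part y M"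
    using p_free_part_exists[of x] p_free_part_exists[of y] assms by auto
  then show ?thesis
    using p_free_part_mult[OF NM] by (simp add: size_fun_eq power_mult_distrib)
qed

text \<open>Here the exponent \<open>p\<close> in \<open>size_fun\<close> pays for the denominator
  of \<open>r\<close>: \<open>2 * p \<le> 2 ^ Suc p \<le> a ^ Suc p\<close>.\<close>

lemma size_fun_r: "2 \<le> size_fun r"
proof -
  have "r * real p ^ 1 = real a * real p ^ 0"
    using p_r by (simp add: mult.commute)
  then have "p_free_part r a"
    unfolding p_free_part_def using a_gt_1 coprime by (metis less_trans zero_less_one)
  then have "size_fun r = real (a ^ Suc p) / real p"
    by (simp add: size_fun_eq r_def)
  moreover have "2 * p \<le> a ^ Suc p"
  proof -
    have "2 * p \<le> 2 ^ Suc p"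
      using less_exp[of p] by simp
    also have "\<dots> \<le> a ^ Suc p"
      using a_gt_1 by (intro power_mono) auto
    finally show ?thesis .
  qed
  then have "2 * real p \<le> real (a ^ Suc p)"
    by (metis of_nat_le_iff of_nat_mult of_nat_numeral)
  ultimately show ?thesis
    using a_less_p by (simp add: pos_le_divide_eq)
qed

text \<open>If \<open>N = 1\<close>, then \<open>x\<close> is a power of \<open>p\<close> exceeding
  \<open>1\<close>, so \<open>x \<ge> p \<ge> 2\<close>. Otherwise \<open>N ^ p \<ge> 2\<close>
  already, and the factor \<open>x > 1\<close> only enlarges it.\<close>

lemma size_fun_gt_1:
  assumes "x \<in> S" "1 < x"
  shows "2 \<le> size_fun x"
proof -
  obtain N where N: "p_free_part x N"
    using assms p_free_part_exists by fastforce
  have "2 \<le> real N ^ p * x"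
  proof (cases "N = 1")
    case True
    then obtain i j where ij: "x * real p ^ i = real p ^ j"
      using N unfolding p_free_part_def by auto
    have p: "2 \<le> real p"
      using a_gt_1 a_less_p by simp
    have "real p ^ i < x * real p ^ i"
      using \<open>1 < x\<close> p by simp
    then have "i < j"
      using ij p by simp
    then obtain k where "j = Suc k + i"
      by (metis add.commute add_Suc_right less_imp_Suc_add)
    then have "x = real p ^ Suc k"
      using ij p by (simp add: power_add)
    moreover have "real p ^ 1 \<le> real p ^ Suc k"
      using p by (intro power_increasing) auto
    ultimately have "2 \<le> x"
      using p unfolding power_one_right by linarith
    then show ?thesis
      using True by simp
  next
    case False
    then have "2 \<le> real N"
      using N unfolding p_free_part_def by simp
    moreover from this have "real N ^ 1 \<le> real N ^ p"
      using a_less_p by (intro power_increasing) auto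
    ultimately have "2 \<le> real N ^ p"
      unfolding power_one_right by linarith
    then have "2 * 1 \<le> real N ^ p * x"
      using \<open>1 < x\<close> by (intro mult_mono) auto
    then show ?thesis by simp
  qed
  then show ?thesis
    using size_fun_eq[OF N] by simp
qed

lemma size_fun_1: "size_fun 1 = 1"
proof -
  have "p_free_part 1 1"
    unfolding p_free_part_def by auto
  then show ?thesis by (simp add: size_fun_eq)
qed

lemma size_fun_ge_2:
  assumes "x \<in> S" "x \<noteq> 0" "x \<noteq> 1"
  shows "2 \<le> size_fun x"
  using assms
proof (induction rule: S_induct)
  case zero
  then show ?case by simp
next
  case (step c y)
  have x_in: "real c + r * y \<in> S"
    using step S_add S_mult S_r S_of_nat by blast
  show ?case
  proof (cases "c = 0")
    case True
    then have "y \<noteq> 0"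
      using step.prems by simp
    \<comment> \<open>The induction hypothesis excludes \<open>y = 1\<close>, where the size is
      exactly \<open>1\<close>; the factor \<open>2\<close> then comes from \<open>r\<close>
      alone.\<close>
    then have "1 \<le> size_fun y"
      using step.IH size_fun_1 by fastforce
    then have "2 * 1 \<le> size_fun r * size_fun y"
      using size_fun_r by (intro mult_mono) auto
    then show ?thesis
      using True size_fun_mult[of r y] S_r r_pos step \<open>y \<noteq> 0\<close> by simp
  next
    case False
    moreover have "0 \<le> r * y"
      using step S_nonneg r_pos by simp
    ultimately have "1 \<le> real c + r * y"
      by (simp add: add_increasing2)
    then have "1 < real c + r * y"
      using step.prems by simp
    then show ?thesis
      using x_in by (rule size_fun_gt_1[rotated])
  qed
qed

lemma atomic_multiplicative: "atomic_monoid (multiplicative_monoid S)"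
proof (rule atomic_monoid_if_multiplicative_size)
  interpret comm_monoid "multiplicative_monoid S"
    using positive_semiring_S by (rule comm_monoid_multiplicative_monoid)
  show "monoid (multiplicative_monoid S)"
    by (rule monoid_axioms)
  show "size_fun (x \<otimes>\<^bsub>multiplicative_monoid S\<^esub> y) = size_fun x * size_fun y"
    if "x \<in> carrier (multiplicative_monoid S)" "y \<in> carrier (multiplicative_monoid S)" for x y
    using that size_fun_mult by (simp add: multiplicative_monoid_def)
  show "2 \<le> size_fun x"
    if "x \<in> carrier (multiplicative_monoid S) - Units (multiplicative_monoid S)" for x
    \<comment> \<open>Since \<open>1\<close> is a unit, a non-unit differs from \<open>1\<close>;
      this is all that is used about the units.\<close>
    using that Units_one_closed size_fun_ge_2[of x] by (auto simp: multiplicative_monoid_def)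
qed

end

theorem proposition4p3:
  fixes q :: rat
  assumes "0 < q" and "q < 1"
    and "fst (quotient_of q) > 1"
    and "prime (snd (quotient_of q))"
  shows "bi_atomic (nat_poly_semiring (of_rat q)) \<and> \<not> bi_ACCP (nat_poly_semiring (of_rat q))"
proof -
  obtain n d where nd: "quotient_of q = (n, d)"
    by fastforce
  have "0 < d" "1 < n" "prime d" "coprime n d"
    using assms nd quotient_of_denom_pos quotient_of_coprime by auto
  have q: "q = of_int n / of_int d"
    using nd by (rule quotient_of_div)
  then have "n < d"
    using \<open>q < 1\<close> \<open>0 < d\<close> by simp
  define a p where "a = nat n" and "p = nat d"
  have n: "n = int a" and d: "d = int p"
    using \<open>1 < n\<close> \<open>0 < d\<close> by (auto simp: a_def p_def)
  interpret proper_fraction a p "real a / real p" "nat_poly_semiring (real a / real p)"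
    using \<open>1 < n\<close> \<open>n < d\<close> \<open>prime d\<close> \<open>coprime n d\<close>
    by unfold_locales (auto simp: n d)
  have "(of_rat q :: real) = real a / real p"
    by (simp add: q n d of_rat_divide)
  then show ?thesis
    using atomic_additive atomic_multiplicative not_ACCP_additive
    by (simp add: bi_atomic_def bi_ACCP_def)
qed

end
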